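(* Let $m\ge2$, let $D\subset\mathbb{R}^{N-1}$ be a bounded domain, and let $H\in C^2(\mathbb{R}^m,\mathbb{R})$ be orientable on $\mathbb{R}^m$. Let $\{a_i,b_i\}_{i=1}^m$ be real constants consistent with the orientability condition, that is, $$\frac{\partial^2H}{\partial p_i\partial p_j}(\mathbf{p})\,(b_i-a_i)(b_j-a_j)<0\quad\text{for all }i\ne j\text{ and all }\mathbf{p}\in\mathbb{R}^m.$$ Assume that $u$ minimizes the energy $$E(v)=\int_{D\times[0,1]}\Big(\frac12\sum_{i=1}^m|\nabla v_i|^2+H(v)\Big)dx$$ in the class of functions $v=(v_1,\dots,v_m)\in C^1(D\times[0,1];\mathbb{R}^m)$ satisfying 1. $v_i(x',0)=a_i$ and $v_i(x',1)=b_i$ for all $x'\in D$ and all $i$; 2. $v$ is $H$-monotone with respect to $x_N$. Then $u(x',x_N)=u(x_N)$ is one-dimensional (it depends only on $x_N$) and the components $u_i$ have common level sets.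
   Context: Points of $D\times[0,1]$ are written $x=(x',x_N)$ with $x'\in D$, $x_N\in[0,1]$. Orientable: $H$ is orientable on a set $\Omega\subseteq\mathbb{R}^m$ if there exist real constants $(\theta_i)_{i=1}^m$ such that for all $i\ne j$, $\theta_i\theta_j\frac{\partial^2H}{\partial p_i\partial p_j}(\mathbf{p})<0$ for all $\mathbf{p}\in\Omega$. $H$-monotone with respect to $x_N$: for every $i$ and every $x\in D\times[0,1]$, $\frac{\partial v_i}{\partial x_N}(x)\ne0$, and for all $i\ne j$ and all $x\in D\times[0,1]$, $\frac{\partial^2H}{\partial p_i\partial p_j}(v(x))\,\frac{\partial v_i}{\partial x_N}(x)\,\frac{\partial v_j}{\partial x_N}(x)<0$. Common level sets: for any $i\ne j$ and any $\lambda\in\mathbb{R}$ there exists $\bar\lambda\in\mathbb{R}$ such that $\{x\in D\times[0,1]:u_i(x)=\lambda\}=\{x\in D\times[0,1]:u_j(x)=\bar\lambda\}$. *)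

theory Defs
  imports "HOL-Analysis.Analysis"
begin

(* Continuously differentiable on S, with derivatives taken within S. On D \<times> {0..1}
   with D open this is C^1 up to the faces x_N = 0 and x_N = 1, where the derivative in
   the last variable is one-sided; nothing is required at the lateral boundary. *)
definition C1_on :: "'a::real_normed_vector set \<Rightarrow> ('a \<Rightarrow> 'b::real_normed_vector) \<Rightarrow> bool" where
  "C1_on S f \<longleftrightarrow> (\<exists>f' :: 'a \<Rightarrow> 'a \<Rightarrow>\<^sub>L 'b.
     (\<forall>x\<in>S. (f has_derivative blinfun_apply (f' x)) (at x within S)) \<and> continuous_on S f')"

(* Only used where the derivative within S exists and is unique: S = UNIV, or
   S = D \<times> {0..1} with D open. *)
definition dir_deriv ::
    "'a::real_normed_vector set \<Rightarrow> 'a \<Rightarrow> ('a \<Rightarrow> real) \<Rightarrow> 'a \<Rightarrow> real" where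
  "dir_deriv S e f x = frechet_derivative f (at x within S) e"

definition grad :: "'a::euclidean_space set \<Rightarrow> ('a \<Rightarrow> real) \<Rightarrow> 'a \<Rightarrow> 'a" where
  "grad S f x = (\<Sum>e\<in>Basis. dir_deriv S e f x *\<^sub>R e)"

definition partial :: "'m::finite \<Rightarrow> (real^'m \<Rightarrow> real) \<Rightarrow> real^'m \<Rightarrow> real" where
  "partial i H = dir_deriv UNIV (axis i 1) H"

definition partial2 :: "'m::finite \<Rightarrow> 'm \<Rightarrow> (real^'m \<Rightarrow> real) \<Rightarrow> real^'m \<Rightarrow> real" where
  "partial2 i j H = partial i (partial j H)"

definition C2 :: "(real^'m::finite \<Rightarrow> real) \<Rightarrow> bool" where
  "C2 H \<longleftrightarrow> C1_on UNIV H \<and> (\<forall>i. C1_on UNIV (partial i H))"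

definition orientable_on :: "(real^'m::finite) set \<Rightarrow> (real^'m \<Rightarrow> real) \<Rightarrow> bool" where
  "orientable_on \<Omega> H \<longleftrightarrow> (\<exists>\<theta> :: 'm \<Rightarrow> real.
     \<forall>i j. i \<noteq> j \<longrightarrow> (\<forall>p\<in>\<Omega>. \<theta> i * \<theta> j * partial2 i j H p < 0))"

abbreviation cyl :: "(real^'n::finite) set \<Rightarrow> ((real^'n) \<times> real) set" where
  "cyl D \<equiv> D \<times> {0..1}"

(* The derivative of the component v_i in the last variable x_N. *)
definition dN :: "(real^'n::finite) set \<Rightarrow> ((real^'n) \<times> real \<Rightarrow> real^'m::finite) \<Rightarrow> 'm
    \<Rightarrow> (real^'n) \<times> real \<Rightarrow> real" where
  "dN D v i x = dir_deriv (cyl D) (0, 1) (\<lambda>y. v y $ i) x"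

definition H_monotone :: "(real^'n::finite) set \<Rightarrow> (real^'m::finite \<Rightarrow> real)
    \<Rightarrow> ((real^'n) \<times> real \<Rightarrow> real^'m) \<Rightarrow> bool" where
  "H_monotone D H v \<longleftrightarrow>
     (\<forall>i. \<forall>x\<in>cyl D. dN D v i x \<noteq> 0) \<and>
     (\<forall>i j. i \<noteq> j \<longrightarrow> (\<forall>x\<in>cyl D. partial2 i j H (v x) * dN D v i x * dN D v j x < 0))"

definition energy_density :: "(real^'n::finite) set \<Rightarrow> (real^'m::finite \<Rightarrow> real)
    \<Rightarrow> ((real^'n) \<times> real \<Rightarrow> real^'m) \<Rightarrow> (real^'n) \<times> real \<Rightarrow> real" where
  "energy_density D H v x =
     1/2 * (\<Sum>i\<in>UNIV. (norm (grad (cyl D) (\<lambda>y. v y $ i) x))\<^sup>2) + H (v x)"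

(* The gradient of a C^1 function on D \<times> {0..1} may fail to be square integrable near
   the lateral boundary, so the energy is the extended-real integral (positive part minus
   negative part). Competitors are bounded (monotone in x_N between a_i and b_i), hence
   H o v is bounded, the negative part is finite, and the difference lies in (-\<infinity>, \<infinity>]. *)
definition energy :: "(real^'n::finite) set \<Rightarrow> (real^'m::finite \<Rightarrow> real)
    \<Rightarrow> ((real^'n) \<times> real \<Rightarrow> real^'m) \<Rightarrow> ereal" where
  "energy D H v =
     enn2ereal (\<integral>\<^sup>+x\<in>cyl D. ennreal (energy_density D H v x) \<partial>lborel)
     - enn2ereal (\<integral>\<^sup>+x\<in>cyl D. ennreal (- energy_density D H v x) \<partial>lborel)"

definition admissible :: "(real^'n::finite) set \<Rightarrow> (real^'m::finite \<Rightarrow> real)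
    \<Rightarrow> real^'m \<Rightarrow> real^'m \<Rightarrow> ((real^'n) \<times> real \<Rightarrow> real^'m) set" where
  "admissible D H a b = {v. C1_on (cyl D) v \<and>
     (\<forall>x'\<in>D. \<forall>i. v (x', 0) $ i = a $ i \<and> v (x', 1) $ i = b $ i) \<and>
     H_monotone D H v}"

definition common_level_sets ::
    "(real^'n::finite) set \<Rightarrow> ((real^'n) \<times> real \<Rightarrow> real^'m::finite) \<Rightarrow> bool" where
  "common_level_sets D u \<longleftrightarrow> (\<forall>i j. i \<noteq> j \<longrightarrow>
     (\<forall>l. \<exists>l'. {x \<in> cyl D. u x $ i = l} = {x \<in> cyl D. u x $ j = l'}))"

end

theory Submission
  imports Defs
begin

text \<open>
  For each \<open>y0\<close> in \<open>D\<close>, freezing \<open>u\<close> at \<open>y0\<close> gives the admissible competitor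
  \<open>(y, t) \<mapsto> u (y0, t)\<close>, whose energy is \<open>|D| e(y0)\<close>, where \<open>e(y0)\<close> is the one-dimensional energy
  of the slice of \<open>u\<close> over \<open>y0\<close>. The energy of \<open>u\<close> itself is the integral over \<open>D\<close> of \<open>e\<close> plus the
  lateral part of the Dirichlet energy. Minimality makes it at most \<open>|D| e(y0)\<close> for every \<open>y0\<close>, so the
  lateral gradient vanishes almost everywhere, hence everywhere by continuity, and \<open>u\<close> is
  one-dimensional. Its components are injective in the last variable, so every level set of a
  component is empty or a single horizontal section of the cylinder.
\<close>

section \<open>Derivatives within the cylinder\<close>

text \<open>Uniqueness needs, at every point and along every coordinate axis, arbitrarily short
  nonzero steps that stay in the cylinder. Openness of \<open>D\<close> supplies the lateral ones;
  in the last variable one sign is enough, so points on the two faces are covered as well.\<close>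

lemma has_derivative_cyl_unique:
  fixes D :: "(real^'n) set" and f :: "(real^'n) \<times> real \<Rightarrow> 'b::real_normed_vector"
  assumes "open D" "x \<in> cyl D"
    and "(f has_derivative f') (at x within cyl D)"
    and "(f has_derivative f'') (at x within cyl D)"
  shows "f' = f''"
  using assms(3,4)
proof (rule frechet_derivative_unique_within)
  fix i :: "(real^'n) \<times> real" and e :: real
  assume i: "i \<in> Basis" and e: "e > 0"
  obtain y t where x: "x = (y, t)" "y \<in> D" "0 \<le> t" "t \<le> 1"
    using assms(2) by auto
  from i consider b where "i = (b, 0)" "b \<in> Basis" | "i = (0, 1)"
    by (auto simp: Basis_prod_def)
  then show "\<exists>d. 0 < \<bar>d\<bar> \<and> \<bar>d\<bar> < e \<and> x + d *\<^sub>R i \<in> cyl D"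
  proof cases
    case 1
    obtain r where r: "r > 0" "ball y r \<subseteq> D"
      using assms(1) x(2) open_contains_ball by blast
    define d where "d = min r e / 2"
    have d: "0 < d" "d < e" "d < r" using r e by (auto simp: d_def)
    have "y + d *\<^sub>R b \<in> ball y r"
      using d 1 by (simp add: dist_norm)
    with r d x 1 show ?thesis by (intro exI[of _ d]) auto
  next
    case 2
    \<comment> \<open>The step points away from the nearer face and has length at most 1/2, so it
      stays inside \<open>{0..1}\<close>.\<close>
    define d where "d = (if t \<le> 1/2 then min 1 e / 2 else - (min 1 e / 2))"
    show ?thesis using x 2 e by (intro exI[of _ d]) (auto simp: d_def)
  qed
qed

text \<open>\<open>dir_deriv\<close> rests on \<open>frechet_derivative\<close>, which is a choice.
  By uniqueness it is an evaluation of the derivative \<open>v'\<close>, so it inherits linearity in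
  the direction and continuity in the point.\<close>

lemma C1_on_cylE:
  fixes D :: "(real^'n) set" and v :: "(real^'n) \<times> real \<Rightarrow> real^'m"
  assumes "open D" "C1_on (cyl D) v"
  obtains v' where "continuous_on (cyl D) v'"
    and "\<And>x. x \<in> cyl D \<Longrightarrow> (v has_derivative blinfun_apply (v' x)) (at x within cyl D)"
    and "\<And>x e i. x \<in> cyl D \<Longrightarrow> dir_deriv (cyl D) e (\<lambda>y. v y $ i) x = v' x e $ i"
proof -
  from assms(2) obtain v' where v': "continuous_on (cyl D) v'"
    "\<And>x. x \<in> cyl D \<Longrightarrow> (v has_derivative blinfun_apply (v' x)) (at x within cyl D)"
    unfolding C1_on_def by blast
  have "dir_deriv (cyl D) e (\<lambda>y. v y $ i) x = v' x e $ i" if x: "x \<in> cyl D" for x e i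
  proof -
    have d: "((\<lambda>y. v y $ i) has_derivative (\<lambda>e. v' x e $ i)) (at x within cyl D)"
      by (rule bounded_linear.has_derivative[OF bounded_linear_vec_nth v'(2)[OF x]])
    then have "((\<lambda>y. v y $ i) has_derivative frechet_derivative (\<lambda>y. v y $ i) (at x within cyl D))
        (at x within cyl D)"
      using differentiableI frechet_derivative_works by blast
    from fun_cong[OF has_derivative_cyl_unique[OF assms(1) x d this], of e] show ?thesis
      by (simp add: dir_deriv_def)
  qed
  with v' that show thesis by blast
qed

section \<open>Lateral and vertical parts of the energy density\<close>

definition lateral_density :: "(real^'n::finite) set
    \<Rightarrow> ((real^'n) \<times> real \<Rightarrow> real^'m::finite) \<Rightarrow> (real^'n) \<times> real \<Rightarrow> real" where
  "lateral_density D v x =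
     1/2 * (\<Sum>i\<in>UNIV. \<Sum>b\<in>Basis. (dir_deriv (cyl D) (b, 0) (\<lambda>y. v y $ i) x)\<^sup>2)"

text \<open>The potential is counted here, so that this is the full energy density of the
  one-dimensional slice through \<open>x\<close>.\<close>

definition vertical_density :: "(real^'n::finite) set \<Rightarrow> (real^'m::finite \<Rightarrow> real)
    \<Rightarrow> ((real^'n) \<times> real \<Rightarrow> real^'m) \<Rightarrow> (real^'n) \<times> real \<Rightarrow> real" where
  "vertical_density D H v x = 1/2 * (\<Sum>i\<in>UNIV. (dN D v i x)\<^sup>2) + H (v x)"

lemma norm_grad_squared:
  "(norm (grad S f x))\<^sup>2 = (\<Sum>e\<in>Basis. (dir_deriv S e f x)\<^sup>2)"
proof -
  have "grad S f x \<bullet> e = dir_deriv S e f x" if "e \<in> Basis" for e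
    using that by (simp add: grad_def inner_sum_left inner_Basis if_distrib cong: if_cong)
  then show ?thesis
    unfolding power2_norm_eq_inner
    by (subst euclidean_inner) (simp add: power2_eq_square)
qed

lemma sum_Basis_prod_real:
  fixes f :: "'a::euclidean_space \<times> real \<Rightarrow> 'b::comm_monoid_add"
  shows "sum f Basis = (\<Sum>b\<in>Basis. f (b, 0)) + f (0, 1)"
  unfolding Basis_prod_def
  by (subst sum.union_disjoint) (auto simp: sum.reindex inj_on_def)

lemma energy_density_split:
  fixes D :: "(real^'n) set"
  shows "energy_density D H v x = lateral_density D v x + vertical_density D H v x"
  unfolding energy_density_def lateral_density_def vertical_density_def norm_grad_squared
    sum_Basis_prod_real dN_def
  by (simp add: sum.distrib algebra_simps)

lemma lateral_density_nonneg: "0 \<le> lateral_density D v x"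
  by (simp add: lateral_density_def sum_nonneg)

lemma lateral_density_eq_0_iff:
  "lateral_density D v x = 0 \<longleftrightarrow>
     (\<forall>i. \<forall>b\<in>Basis. dir_deriv (cyl D) (b, 0) (\<lambda>y. v y $ i) x = 0)"
  by (simp add: lateral_density_def sum_nonneg sum_nonneg_eq_0_iff)

lemma C1_on_imp_continuous_on:
  assumes "C1_on S v"
  shows "continuous_on S v"
proof -
  from assms obtain v' where
    "\<forall>x\<in>S. (v has_derivative blinfun_apply (v' x)) (at x within S)"
    unfolding C1_on_def by blast
  then show ?thesis
    by (intro has_derivative_continuous_on[where f' = "\<lambda>x. blinfun_apply (v' x)"]) blast
qed

lemma C2_imp_continuous_on:
  assumes "C2 H"
  shows "continuous_on S H"
  using assms C1_on_imp_continuous_on[of UNIV H] continuous_on_subset[of UNIV H S]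
  by (simp add: C2_def)

lemma continuous_on_densities:
  fixes D :: "(real^'n) set" and v :: "(real^'n) \<times> real \<Rightarrow> real^'m"
  assumes "open D" "C1_on (cyl D) v" "C2 H"
  shows "continuous_on (cyl D) (lateral_density D v)"
    and "continuous_on (cyl D) (vertical_density D H v)"
    and "continuous_on (cyl D) (energy_density D H v)"
proof -
  obtain v' where v': "continuous_on (cyl D) v'"
    "\<And>x. x \<in> cyl D \<Longrightarrow> (v has_derivative blinfun_apply (v' x)) (at x within cyl D)"
    "\<And>x e i. x \<in> cyl D \<Longrightarrow> dir_deriv (cyl D) e (\<lambda>y. v y $ i) x = v' x e $ i"
    by (rule C1_on_cylE[OF assms(1,2)], rule that)
  have d: "continuous_on (cyl D) (dir_deriv (cyl D) e (\<lambda>y. v y $ i))" for e i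
  proof (rule continuous_on_eq)
    show "continuous_on (cyl D) (\<lambda>x. v' x e $ i)"
      by (intro continuous_intros v'(1))
  qed (simp add: v'(3))
  have H: "continuous_on (cyl D) (\<lambda>x. H (v x))"
    by (rule continuous_on_compose2[OF C2_imp_continuous_on[OF assms(3), of UNIV]
          C1_on_imp_continuous_on[OF assms(2)]]) simp
  show l: "continuous_on (cyl D) (lateral_density D v)"
    unfolding lateral_density_def by (intro continuous_intros d)
  show r: "continuous_on (cyl D) (vertical_density D H v)"
    unfolding vertical_density_def dN_def by (intro continuous_intros d H)
  show "continuous_on (cyl D) (energy_density D H v)"
    unfolding energy_density_split by (intro continuous_intros l r)
qed

section \<open>Admissible functions along the last variable\<close>

lemma dN_has_real_derivative:
  fixes D :: "(real^'n) set" and v :: "(real^'n) \<times> real \<Rightarrow> real^'m"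
  assumes "open D" "C1_on (cyl D) v" "y \<in> D" "t \<in> {0..1}"
  shows "((\<lambda>t. v (y, t) $ i) has_real_derivative dN D v i (y, t)) (at t within {0..1})"
proof -
  obtain v' where v': "continuous_on (cyl D) v'"
    "\<And>x. x \<in> cyl D \<Longrightarrow> (v has_derivative blinfun_apply (v' x)) (at x within cyl D)"
    "\<And>x e i. x \<in> cyl D \<Longrightarrow> dir_deriv (cyl D) e (\<lambda>y. v y $ i) x = v' x e $ i"
    by (rule C1_on_cylE[OF assms(1,2)], rule that)
  have x: "(y, t) \<in> cyl D" using assms by auto
  have p: "(Pair y has_derivative (\<lambda>h. (0, h))) (at t within {0..1})"
    by (auto intro!: derivative_eq_intros)
  have "(v has_derivative v' (y, t)) (at (y, t) within Pair y ` {0..1})"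
    by (rule has_derivative_subset[OF v'(2)[OF x]]) (use assms(3) in auto)
  from diff_chain_within[OF p this]
  have "((\<lambda>t. v (y, t)) has_derivative (\<lambda>h. v' (y, t) (0, h))) (at t within {0..1})"
    by (simp add: o_def)
  from bounded_linear.has_derivative[OF bounded_linear_vec_nth this, of i]
  have "((\<lambda>t. v (y, t) $ i) has_derivative (\<lambda>h. v' (y, t) (0, h) $ i)) (at t within {0..1})" .
  moreover have "(\<lambda>h. v' (y, t) (0, h) $ i) = (*) (v' (y, t) (0, 1) $ i)"
  proof
    fix h
    have "v' (y, t) (h *\<^sub>R (0, 1)) = h *\<^sub>R v' (y, t) (0, 1)" by (rule blinfun.scaleR_right)
    then show "v' (y, t) (0, h) $ i = v' (y, t) (0, 1) $ i * h" by simp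
  qed
  ultimately show ?thesis
    unfolding has_field_derivative_def dN_def v'(3)[OF x] by simp
qed

text \<open>Rolle's theorem: equal values at two heights would force a zero of the vertical
  derivative strictly between them.\<close>

lemma dN_nonzero_imp_inj_on:
  fixes D :: "(real^'n) set" and v :: "(real^'n) \<times> real \<Rightarrow> real^'m"
  assumes "open D" "C1_on (cyl D) v" "y \<in> D" "\<And>x. x \<in> cyl D \<Longrightarrow> dN D v i x \<noteq> 0"
  shows "inj_on (\<lambda>t. v (y, t) $ i) {0..1}"
proof -
  note der = dN_has_real_derivative[OF assms(1-3), of _ i]
  have "v (y, s) $ i \<noteq> v (y, t) $ i" if st: "s < t" "s \<in> {0..1}" "t \<in> {0..1}" for s t
  proof
    assume eq: "v (y, s) $ i = v (y, t) $ i"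
    have "\<exists>z. s < z \<and> z < t \<and> (\<lambda>h. dN D v i (y, z) * h) = (\<lambda>h. 0)"
    proof (rule Rolle_deriv[OF st(1) eq])
      have "continuous_on {0..1} (\<lambda>t. v (y, t) $ i)"
        by (rule DERIV_continuous_on[OF der])
      then show "continuous_on {s..t} (\<lambda>t. v (y, t) $ i)"
        by (rule continuous_on_subset) (use st in auto)
      fix z assume z: "s < z" "z < t"
      with st have z': "z \<in> {0..1}" "z \<in> interior {0..1}" by auto
      show "((\<lambda>t. v (y, t) $ i) has_derivative (\<lambda>h. dN D v i (y, z) * h)) (at z)"
        using der[OF z'(1)] unfolding at_within_interior[OF z'(2)] has_field_derivative_def .
    qed
    then obtain z where z: "s < z" "z < t" "(\<lambda>h. dN D v i (y, z) * h) = (\<lambda>h. 0)"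
      by blast
    have "dN D v i (y, z) = 0" using fun_cong[OF z(3), of 1] by simp
    moreover have "(y, z) \<in> cyl D" using assms(3) st z by auto
    ultimately show False using assms(4) by blast
  qed
  then show ?thesis
    unfolding inj_on_def by (metis linorder_neqE)
qed

lemma admissibleD:
  assumes "v \<in> admissible D H a b"
  shows "C1_on (cyl D) v"
    and "y \<in> D \<Longrightarrow> v (y, 0) $ i = a $ i"
    and "y \<in> D \<Longrightarrow> v (y, 1) $ i = b $ i"
    and "x \<in> cyl D \<Longrightarrow> dN D v i x \<noteq> 0"
    and "x \<in> cyl D \<Longrightarrow> i \<noteq> j \<Longrightarrow> partial2 i j H (v x) * dN D v i x * dN D v j x < 0"
proof -
  have v: "C1_on (cyl D) v"
      "\<forall>x'\<in>D. \<forall>i. v (x', 0) $ i = a $ i \<and> v (x', 1) $ i = b $ i" "H_monotone D H v"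
    using assms unfolding admissible_def mem_Collect_eq by simp_all
  show "C1_on (cyl D) v" by (rule v(1))
  show "v (y, 0) $ i = a $ i" "v (y, 1) $ i = b $ i" if "y \<in> D"
    using bspec[OF v(2) that] by simp_all
  show "dN D v i x \<noteq> 0" if "x \<in> cyl D"
    by (rule v(3)[unfolded H_monotone_def, THEN conjunct1, rule_format, OF that])
  show "partial2 i j H (v x) * dN D v i x * dN D v j x < 0" if "x \<in> cyl D" "i \<noteq> j"
    by (rule v(3)[unfolded H_monotone_def, THEN conjunct2, rule_format, OF that(2,1)])
qed

text \<open>A continuous injective function on an interval is monotone, so its values lie between
  those on the two faces. This confines all values of \<open>v\<close> to a compact box depending
  only on \<open>a\<close> and \<open>b\<close>.\<close>

lemma admissible_component_between:
  fixes D :: "(real^'n) set"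
  assumes "open D" "v \<in> admissible D H a b" "x \<in> cyl D"
  shows "v x $ i \<in> {min (a $ i) (b $ i)..max (a $ i) (b $ i)}"
proof -
  obtain y t where x: "x = (y, t)" "y \<in> D" "0 \<le> t" "t \<le> 1" using assms(3) by auto
  have v: "C1_on (cyl D) v" "v (y, 0) $ i = a $ i" "v (y, 1) $ i = b $ i"
    "\<And>x. x \<in> cyl D \<Longrightarrow> dN D v i x \<noteq> 0"
    using admissibleD[OF assms(2)] x(2) by simp_all
  have inj: "inj_on (\<lambda>t. v (y, t) $ i) {0..1}"
    by (rule dN_nonzero_imp_inj_on[OF assms(1) v(1) x(2) v(4)])
  have cont: "continuous_on {0..1} (\<lambda>t. v (y, t) $ i)"
    by (rule DERIV_continuous_on[OF dN_has_real_derivative[OF assms(1) v(1) x(2)]])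
  consider "t = 0" | "t = 1" | "0 < t" "t < 1" using x by linarith
  then show ?thesis
  proof cases
    case 3
    from continuous_inj_imp_mono[OF 3 cont inj] show ?thesis using x v by auto
  qed (use x v in auto)
qed

section \<open>Frozen slices as competitors\<close>

lemma dir_deriv_slice:
  fixes D :: "(real^'n) set" and u :: "(real^'n) \<times> real \<Rightarrow> real^'m"
  assumes "open D" "C1_on (cyl D) u" "y0 \<in> D"
  defines "v \<equiv> \<lambda>x. u (y0, snd x)"
  shows "C1_on (cyl D) v"
    and "x \<in> cyl D \<Longrightarrow> dir_deriv (cyl D) e (\<lambda>y. v y $ i) x
           = dir_deriv (cyl D) (0, snd e) (\<lambda>y. u y $ i) (y0, snd x)"
proof -
  obtain u' where u': "continuous_on (cyl D) u'"
    "\<And>x. x \<in> cyl D \<Longrightarrow> (u has_derivative blinfun_apply (u' x)) (at x within cyl D)"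
    "\<And>x e i. x \<in> cyl D \<Longrightarrow> dir_deriv (cyl D) e (\<lambda>y. u y $ i) x = u' x e $ i"
    by (rule C1_on_cylE[OF assms(1,2)], rule that)
  define L :: "((real^'n) \<times> real) \<Rightarrow>\<^sub>L ((real^'n) \<times> real)" where "L = Blinfun (\<lambda>e. (0, snd e))"
  have L: "blinfun_apply L = (\<lambda>e. (0, snd e))"
    unfolding L_def by (intro bounded_linear_Blinfun_apply bounded_linear_intros)
  define v' where "v' = (\<lambda>x :: (real^'n) \<times> real. u' (y0, snd x) o\<^sub>L L)"
  have c: "continuous_on (cyl D) v'"
    unfolding v'_def
    by (intro continuous_intros continuous_on_compose2[OF u'(1)]) (use assms(3) in auto)
  have d: "(v has_derivative blinfun_apply (v' x)) (at x within cyl D)" if x: "x \<in> cyl D" for x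
  proof -
    have p: "((\<lambda>x. (y0, snd x)) has_derivative (\<lambda>e. (0, snd e))) (at x within cyl D)"
      by (auto intro!: derivative_eq_intros)
    have "(u has_derivative u' (y0, snd x)) (at (y0, snd x) within (\<lambda>x. (y0, snd x)) ` cyl D)"
      by (rule has_derivative_subset[OF u'(2)]) (use assms(3) x in auto)
    from diff_chain_within[OF p this]
    have "(v has_derivative (\<lambda>e. u' (y0, snd x) (0, snd e))) (at x within cyl D)"
      by (simp add: o_def v_def)
    moreover have "blinfun_apply (v' x) = (\<lambda>e. u' (y0, snd x) (0, snd e))"
      by (simp add: fun_eq_iff v'_def L)
    ultimately show ?thesis by simp
  qed
  show C: "C1_on (cyl D) v" unfolding C1_on_def using c d by blast
  show "dir_deriv (cyl D) e (\<lambda>y. v y $ i) x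
           = dir_deriv (cyl D) (0, snd e) (\<lambda>y. u y $ i) (y0, snd x)" if x: "x \<in> cyl D"
  proof -
    obtain v'' where v'': "continuous_on (cyl D) v''"
      "\<And>x. x \<in> cyl D \<Longrightarrow> (v has_derivative blinfun_apply (v'' x)) (at x within cyl D)"
      "\<And>x e i. x \<in> cyl D \<Longrightarrow> dir_deriv (cyl D) e (\<lambda>y. v y $ i) x = v'' x e $ i"
      by (rule C1_on_cylE[OF assms(1) C], rule that)
    \<comment> \<open>\<open>v''\<close> is some derivative of the slice, known to compute
      \<open>dir_deriv\<close>; uniqueness identifies it with the explicit
      \<open>v'\<close>.\<close>
    have "blinfun_apply (v'' x) = blinfun_apply (v' x)"
      by (rule has_derivative_cyl_unique[OF assms(1) x v''(2)[OF x] d[OF x]])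
    moreover have "(y0, snd x) \<in> cyl D" using x assms(3) by auto
    ultimately show ?thesis by (simp add: v''(3)[OF x] u'(3) v'_def L)
  qed
qed

text \<open>The boundary values and \<open>H\<close>-monotonicity involve only values and vertical
  derivatives at single points, and those of the slice at \<open>x\<close> are those of
  \<open>u\<close> at \<open>(y0, snd x)\<close>.\<close>

lemma slice_admissible:
  fixes D :: "(real^'n) set" and u :: "(real^'n) \<times> real \<Rightarrow> real^'m"
  assumes "open D" "u \<in> admissible D H a b" "y0 \<in> D"
  shows "(\<lambda>x. u (y0, snd x)) \<in> admissible D H a b"
proof -
  let ?v = "\<lambda>x. u (y0, snd x)"
  note C = admissibleD(1)[OF assms(2)]
  note adm = admissibleD[OF assms(2)]
  have dN: "dN D ?v i x = dN D u i (y0, snd x)" if "x \<in> cyl D" for i x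
    unfolding dN_def using dir_deriv_slice(2)[OF assms(1) C assms(3) that] by simp
  have mem: "(y0, snd x) \<in> cyl D" if "x \<in> cyl D" for x using assms(3) that by auto
  have "H_monotone D H ?v"
    unfolding H_monotone_def
  proof (intro conjI allI ballI impI)
    fix i :: 'm and x assume x: "x \<in> cyl D"
    show "dN D ?v i x \<noteq> 0" unfolding dN[OF x] by (rule adm(4)[OF mem[OF x]])
  next
    fix i j :: 'm and x assume "i \<noteq> j" and x: "x \<in> cyl D"
    then show "partial2 i j H (?v x) * dN D ?v i x * dN D ?v j x < 0"
      unfolding dN[OF x] by (intro adm(5)[OF mem[OF x]])
  qed
  then show ?thesis
    using adm(2,3)[OF assms(3)] dir_deriv_slice(1)[OF assms(1) C assms(3)]
    by (simp add: admissible_def)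
qed

text \<open>Freezing turns every lateral direction into \<open>(0, 0)\<close>, where the linear
  derivative vanishes, so only the vertical part survives.\<close>

lemma slice_energy_density:
  assumes "open D" "C1_on (cyl D) u" "y0 \<in> D" "x \<in> cyl D"
  shows "energy_density D H (\<lambda>x. u (y0, snd x)) x = vertical_density D H u (y0, snd x)"
proof -
  have "dir_deriv (cyl D) (0, 0) (\<lambda>y. u y $ i) (y0, snd x) = 0" for i
  proof -
    obtain u' where u': "continuous_on (cyl D) u'"
      "\<And>x. x \<in> cyl D \<Longrightarrow> (u has_derivative blinfun_apply (u' x)) (at x within cyl D)"
      "\<And>x e i. x \<in> cyl D \<Longrightarrow> dir_deriv (cyl D) e (\<lambda>y. u y $ i) x = u' x e $ i"
      by (rule C1_on_cylE[OF assms(1,2)], rule that)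
    have "(y0, snd x) \<in> cyl D" using assms(3,4) by auto
    moreover have "u' (y0, snd x) (0, 0) = 0"
      using blinfun.zero_right[of "u' (y0, snd x)"] by (simp add: zero_prod_def)
    ultimately show ?thesis by (simp add: u'(3))
  qed
  then show ?thesis
    unfolding energy_density_split
    by (simp add: lateral_density_def vertical_density_def dN_def
        dir_deriv_slice(2)[OF assms])
qed

section \<open>Energies as iterated integrals\<close>

lemma energy_eq_integral:
  assumes "set_integrable lborel (cyl D) (energy_density D H v)"
  shows "energy D H v = ereal (LINT x:cyl D|lborel. energy_density D H v x)"
proof -
  let ?g = "\<lambda>x. indicator (cyl D) x *\<^sub>R energy_density D H v x"
  have "integrable lborel ?g" using assms by (simp add: set_integrable_def)
  then obtain r q where *: "0 \<le> r" "0 \<le> q" "(\<integral>\<^sup>+x. ennreal (?g x) \<partial>lborel) = ennreal r"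
    "(\<integral>\<^sup>+x. ennreal (- ?g x) \<partial>lborel) = ennreal q" "integral\<^sup>L lborel ?g = r - q"
    by (rule integrableE)
  then show ?thesis
    unfolding energy_def set_lebesgue_integral_def
    by (simp add: nn_integral_set_ennreal mult.commute[of "indicator _ _"])
qed

lemma continuous_set_integrable_slice:
  fixes f :: "'a::topological_space \<times> real \<Rightarrow> real"
  assumes "continuous_on (D \<times> {0..1}) f" "y \<in> D"
  shows "continuous_on {0..1} (\<lambda>t. f (y, t))"
    and "set_integrable lborel {0..1} (\<lambda>t. f (y, t))"
proof -
  show c: "continuous_on {0..1} (\<lambda>t. f (y, t))"
    by (rule continuous_on_compose2[OF assms(1)]) (use assms(2) in \<open>auto intro!: continuous_intros\<close>)
  show "set_integrable lborel {0..1} (\<lambda>t. f (y, t))"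
    unfolding set_integrable_def by (rule borel_integrable_compact[OF compact_Icc c])
qed

text \<open>Fubini for the integrand extended by zero. Continuity makes the inner integral exist
  over every \<open>y\<close> in \<open>D\<close>, not just almost every one, and lets it be written
  as \<open>integral\<close>.\<close>

lemma cyl_integral_fubini:
  fixes D :: "(real^'n) set" and f :: "(real^'n) \<times> real \<Rightarrow> real"
  assumes "continuous_on (cyl D) f" "set_integrable lborel (cyl D) f"
  shows "integrable lborel (\<lambda>y. indicator D y * integral {0..1} (\<lambda>t. f (y, t)))"
    and "(LINT x:cyl D|lborel. f x)
           = (LINT y|lborel. indicator D y * integral {0..1} (\<lambda>t. f (y, t)))"
proof -
  let ?g = "\<lambda>x. indicator (cyl D) x *\<^sub>R f x"
  have i: "integrable (lborel \<Otimes>\<^sub>M lborel) ?g"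
    using assms(2) by (simp add: set_integrable_def lborel_prod)
  have eq: "(LINT t|lborel. ?g (y, t)) = indicator D y * integral {0..1} (\<lambda>t. f (y, t))" for y
  proof (cases "y \<in> D")
    case True
    then have "(LINT t|lborel. ?g (y, t)) = (LINT t:{0..1}|lborel. f (y, t))"
      unfolding set_lebesgue_integral_def by (intro Bochner_Integration.integral_cong) (auto simp: indicator_def)
    also have "\<dots> = integral {0..1} (\<lambda>t. f (y, t))"
      by (rule set_borel_integral_eq_integral(2)[OF continuous_set_integrable_slice(2)[OF assms(1) True]])
    finally show ?thesis using True by simp
  qed simp
  show "integrable lborel (\<lambda>y. indicator D y * integral {0..1} (\<lambda>t. f (y, t)))"
    using lborel_pair.integrable_fst'[OF i] by (simp only: eq)
  show "(LINT x:cyl D|lborel. f x)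
           = (LINT y|lborel. indicator D y * integral {0..1} (\<lambda>t. f (y, t)))"
    using lborel_pair.integral_fst'[OF i]
    by (simp only: eq lborel_prod set_lebesgue_integral_def)
qed

lemma emeasure_cyl_finite:
  fixes D :: "(real^'n) set"
  assumes "bounded D"
  shows "emeasure lborel (cyl D) < \<infinity>"
  by (intro emeasure_bounded_finite bounded_Times assms) simp

lemma sets_cyl: "open D \<Longrightarrow> cyl D \<in> sets borel"
  by (intro borel_Times) auto

text \<open>The density of the slice depends on the height only and is bounded there by compactness.
  It is therefore integrable over the bounded cylinder, and Fubini yields the factor
  \<open>measure lborel D\<close>.\<close>

lemma energy_slice:
  assumes "open D" "bounded D" "C1_on (cyl D) u" "C2 H" "y0 \<in> D"
  shows "energy D H (\<lambda>x. u (y0, snd x))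
    = ereal (measure lborel D * integral {0..1} (\<lambda>t. vertical_density D H u (y0, t)))"
proof -
  let ?v = "\<lambda>x. u (y0, snd x)" and ?e = "\<lambda>t. vertical_density D H u (y0, t)"
  have c: "continuous_on (cyl D) (energy_density D H ?v)"
    by (rule continuous_on_densities(3)[OF assms(1) dir_deriv_slice(1)[OF assms(1,3,5)] assms(4)])
  have "continuous_on {0..1} ?e"
    by (rule continuous_set_integrable_slice(1)[OF continuous_on_densities(2)[OF assms(1,3,4)] assms(5)])
  then have "bounded (?e ` {0..1})"
    by (intro compact_imp_bounded compact_continuous_image) auto
  then obtain K where "\<forall>x\<in>?e ` {0..1}. norm x \<le> K"
    unfolding bounded_iff by blast
  then have K: "\<bar>?e t\<bar> \<le> K" if "t \<in> {0..1}" for t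
    using that by simp
  have i: "set_integrable lborel (cyl D) (energy_density D H ?v)"
    unfolding set_integrable_def
  proof (rule integrableI_bounded_set)
    show "cyl D \<in> sets lborel" using sets_cyl[OF assms(1)] by simp
    show "(\<lambda>x. indicator (cyl D) x *\<^sub>R energy_density D H ?v x) \<in> borel_measurable lborel"
      using borel_measurable_continuous_on_indicator[OF sets_cyl[OF assms(1)] c] by simp
    show "emeasure lborel (cyl D) < \<infinity>" by (rule emeasure_cyl_finite[OF assms(2)])
    show "AE x in lborel. x \<in> cyl D \<longrightarrow>
        norm (indicator (cyl D) x *\<^sub>R energy_density D H ?v x) \<le> K"
      using K by (auto simp: slice_energy_density[OF assms(1,3,5)])
  qed simp
  have "integral {0..1} (\<lambda>t. energy_density D H ?v (y, t)) = integral {0..1} ?e" if "y \<in> D" for y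
    by (rule integral_cong) (use that slice_energy_density[OF assms(1,3,5)] in auto)
  then have "(\<lambda>y. indicator D y * integral {0..1} (\<lambda>t. energy_density D H ?v (y, t)))
      = (\<lambda>y. indicator D y * integral {0..1} ?e)"
    by (auto simp: indicator_def)
  then have "(LINT x:cyl D|lborel. energy_density D H ?v x) = measure lborel D * integral {0..1} ?e"
    using cyl_integral_fubini(2)[OF c i] by simp
  then show ?thesis using energy_eq_integral[OF i] by simp
qed

text \<open>The gradient of \<open>u\<close> may blow up at the lateral boundary, so integrability
  has to come from the energy. The density is bounded below, hence its negative part has finite
  integral, and finite energy then controls the positive part.\<close>

lemma finite_energy_imp_integrable:
  assumes "open D" "bounded D" "C2 H" "u \<in> admissible D H a b" "energy D H u \<noteq> \<infinity>"
  shows "set_integrable lborel (cyl D) (energy_density D H u)"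
proof -
  let ?g = "\<lambda>x. indicator (cyl D) x *\<^sub>R energy_density D H u x"
  note C = admissibleD(1)[OF assms(4)]
  \<comment> \<open>Minima and maxima appear because a component may increase or decrease from
    \<open>a $ i\<close> to \<open>b $ i\<close>.\<close>
  define Q where "Q = cbox (\<chi> i. min (a $ i) (b $ i)) (\<chi> i. max (a $ i) (b $ i))"
  have "bounded (H ` Q)"
    unfolding Q_def
    by (intro compact_imp_bounded compact_continuous_image C2_imp_continuous_on assms(3)) auto
  then obtain K where K: "\<And>p. p \<in> Q \<Longrightarrow> \<bar>H p\<bar> \<le> K"
    by (auto simp: bounded_iff)
  have lower: "- energy_density D H u x \<le> K" if "x \<in> cyl D" for x
  proof -
    have "u x \<in> Q"
      using admissible_component_between[OF assms(1,4) that] by (auto simp: Q_def mem_box_cart)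
    then have "- H (u x) \<le> K" using K by fastforce
    moreover have "0 \<le> (\<Sum>i\<in>UNIV. (norm (grad (cyl D) (\<lambda>y. u y $ i) x))\<^sup>2)"
      by (simp add: sum_nonneg)
    ultimately show ?thesis by (simp add: energy_density_def)
  qed
  have "(\<integral>\<^sup>+x. ennreal (- ?g x) \<partial>lborel) \<le> (\<integral>\<^sup>+x. ennreal K * indicator (cyl D) x \<partial>lborel)"
    by (intro nn_integral_mono) (auto simp: indicator_def lower ennreal_leI)
  also have "\<dots> = ennreal K * emeasure lborel (cyl D)"
    by (rule nn_integral_cmult_indicator) (use sets_cyl[OF assms(1)] in simp)
  also have "\<dots> < \<infinity>"
    using emeasure_cyl_finite[OF assms(2)] by (simp add: ennreal_mult_less_top)
  finally have neg: "(\<integral>\<^sup>+x. ennreal (- ?g x) \<partial>lborel) < \<infinity>" .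
  \<comment> \<open>An infinite positive part minus a finite negative part would make the energy
    infinite.\<close>
  then have pos: "(\<integral>\<^sup>+x. ennreal (?g x) \<partial>lborel) \<noteq> \<infinity>"
    using assms(5) unfolding energy_def
    by (auto simp: nn_integral_set_ennreal mult.commute[of "indicator _ _"])
  have "?g \<in> borel_measurable borel"
    by (intro borel_measurable_continuous_on_indicator sets_cyl
        continuous_on_densities(3) assms C)
  then show ?thesis
    unfolding set_integrable_def real_integrable_def using neg pos by auto
qed

section \<open>Minimality forces the lateral gradient to vanish\<close>

text \<open>With \<open>c\<close> the mean over \<open>D\<close> of the slice energies
  \<open>F\<close>, minimality gives \<open>c \<le> e \<le> F\<close> on \<open>D\<close>. A
  function bounded below by its own mean equals it almost everywhere, so \<open>e = F\<close> almost
  everywhere.\<close>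

lemma minimizer_lateral_density_zero:
  fixes D :: "(real^'n) set"
  assumes "open D" "bounded D" "C2 H" "u \<in> admissible D H a b"
    and min: "\<And>v. v \<in> admissible D H a b \<Longrightarrow> energy D H u \<le> energy D H v"
    and "y \<in> D" "t \<in> {0..1}"
  shows "lateral_density D u (y, t) = 0"
proof -
  note C = admissibleD(1)[OF assms(4)]
  note cont = continuous_on_densities[OF assms(1) C assms(3)]
  define e where "e y = integral {0..1} (\<lambda>t. vertical_density D H u (y, t))" for y
  define F where "F y = integral {0..1} (\<lambda>t. energy_density D H u (y, t))" for y
  define M where "M = measure lborel D"
  have pos: "emeasure lborel D \<noteq> 0"
  proof
    assume "emeasure lborel D = 0"
    then have "AE y in lborel. y \<notin> D"
      using assms(1) by (intro AE_not_in) (simp add: null_sets_def)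
    \<comment> \<open>A property that holds almost everywhere on an open set and defines a closed
      set holds everywhere on it. With the closed set \<open>{}\<close> this shows that a nonempty
      open set is not null.\<close>
    then have "AE y\<in>D in lebesgue. y \<in> {}"
      using AE_completion by fastforce
    then show False
      using mem_closed_if_AE_lebesgue_open[of D "{}"] assms(1,6) by blast
  qed
  have fin: "emeasure lborel D < \<infinity>" by (rule emeasure_bounded_finite[OF assms(2)])
  have M: "M > 0"
    using pos fin by (simp add: M_def measure_def enn2real_positive_iff less_top zero_less_iff_neq_zero)
  have le: "energy D H u \<le> ereal (M * e y0)" if "y0 \<in> D" for y0
    using min[OF slice_admissible[OF assms(1,4) that]] energy_slice[OF assms(1,2) C assms(3) that]
    by (simp add: M_def e_def)
  then have "energy D H u \<noteq> \<infinity>" using assms(6) by fastforce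
  note int = finite_energy_imp_integrable[OF assms(1,2,3,4) this]
  note fub = cyl_integral_fubini[OF cont(3) int, folded F_def]
  define c where "c = (LINT y|lborel. indicator D y * F y) / M"
  \<comment> \<open>By Fubini \<open>M * c\<close> is the energy of \<open>u\<close>, while
    \<open>M * e y0\<close> is the energy of the slice frozen at \<open>y0\<close>.\<close>
  have c_le: "c \<le> e y0" if "y0 \<in> D" for y0
    using le[OF that] M energy_eq_integral[OF int] fub(2) by (simp add: c_def field_simps)
  have F_ge: "F y0 \<ge> e y0" if "y0 \<in> D" for y0
    unfolding F_def e_def
    by (intro integral_le integrable_continuous_interval continuous_set_integrable_slice(1)[OF _ that] cont)
      (simp add: energy_density_split lateral_density_nonneg)
  have iD: "integrable lborel (\<lambda>y. indicator D y * c)"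
    using assms(1) fin by simp
  have "(LINT y|lborel. indicator D y * F y - indicator D y * c) = 0"
    using M by (subst Bochner_Integration.integral_diff[OF fub(1) iD]) (simp add: c_def M_def)
  moreover have "AE y in lborel. 0 \<le> indicator D y * F y - indicator D y * c"
    using F_ge c_le by (intro AE_I2) (force simp: indicator_def)
  ultimately have "AE y in lborel. indicator D y * F y - indicator D y * c = 0"
    using integral_nonneg_eq_0_iff_AE[OF Bochner_Integration.integrable_diff[OF fub(1) iD]] by simp
  then have AE: "AE y in lborel. y \<in> D \<longrightarrow> lateral_density D u (y, t) = 0"
  proof eventually_elim
    case (elim y)
    show ?case
    proof
      assume y: "y \<in> D"
      note sl = continuous_set_integrable_slice(1)[OF _ y]
      \<comment> \<open>Where \<open>F y = c\<close>, the lateral part of the slice energy is at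
        most 0. Its integrand is continuous and nonnegative, so it vanishes at every height, in
        particular at the fixed \<open>t\<close>.\<close>
      have "F y = integral {0..1} (\<lambda>t. lateral_density D u (y, t)) + e y"
        unfolding F_def e_def energy_density_split
        by (intro integral_add integrable_continuous_interval sl cont)
      moreover have "F y \<le> e y" using elim y c_le[OF y] by simp
      moreover have "0 \<le> integral {0..1} (\<lambda>t. lateral_density D u (y, t))"
        by (intro integral_nonneg integrable_continuous_interval sl cont lateral_density_nonneg)
      ultimately have "integral {0..1} (\<lambda>t. lateral_density D u (y, t)) = 0" by simp
      then show "lateral_density D u (y, t) = 0"
        using integral_eq_0_iff[OF sl[OF cont(1)] zero_less_one lateral_density_nonneg] assms(7)
        by blast
    qed
  qed
  \<comment> \<open>The exceptional set at height \<open>t\<close> is open by continuity and null by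
    the preceding step, hence empty.\<close>
  define S where "S = {y \<in> D. lateral_density D u (y, t) \<noteq> 0}"
  have "continuous_on D (\<lambda>y. lateral_density D u (y, t))"
    by (rule continuous_on_compose2[OF cont(1)]) (use assms(7) in \<open>auto intro!: continuous_intros\<close>)
  then have "open (D \<inter> (\<lambda>y. lateral_density D u (y, t)) -` (- {0}))"
    using assms(1) by (rule continuous_open_preimage) auto
  also have "D \<inter> (\<lambda>y. lateral_density D u (y, t)) -` (- {0}) = S" by (auto simp: S_def)
  finally have "open S" .
  moreover have "AE y\<in>S in lebesgue. y \<in> {}"
    using AE_completion[OF AE] by eventually_elim (auto simp: S_def)
  ultimately have "y \<notin> S" using mem_closed_if_AE_lebesgue_open[of S "{}"] by blast
  then show ?thesis using assms(6) by (simp add: S_def)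
qed

section \<open>One-dimensionality and level sets\<close>

text \<open>The lateral density is half a sum of squares, so its vanishing kills the derivative of
  \<open>u\<close> on the horizontal section at height \<open>t\<close>; connectedness of
  \<open>D\<close> then gives constancy.\<close>

lemma lateral_density_zero_imp_constant:
  fixes D :: "(real^'n) set" and u :: "(real^'n) \<times> real \<Rightarrow> real^'m"
  assumes "open D" "connected D" "C1_on (cyl D) u" "t \<in> {0..1}"
    and z: "\<And>y. y \<in> D \<Longrightarrow> lateral_density D u (y, t) = 0"
    and "y \<in> D" "z \<in> D"
  shows "u (y, t) = u (z, t)"
proof (rule has_derivative_zero_unique_connected[OF assms(1,2) _ assms(6,7)])
  fix y assume y: "y \<in> D"
  obtain u' where u': "continuous_on (cyl D) u'"
    "\<And>x. x \<in> cyl D \<Longrightarrow> (u has_derivative blinfun_apply (u' x)) (at x within cyl D)"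
    "\<And>x e i. x \<in> cyl D \<Longrightarrow> dir_deriv (cyl D) e (\<lambda>y. u y $ i) x = u' x e $ i"
    by (rule C1_on_cylE[OF assms(1,3)], rule that)
  have x: "(y, t) \<in> cyl D" using y assms(4) by auto
  have p: "((\<lambda>y. (y, t)) has_derivative (\<lambda>h. (h, 0))) (at y within D)"
    by (auto intro!: derivative_eq_intros)
  have "(u has_derivative u' (y, t)) (at (y, t) within (\<lambda>y. (y, t)) ` D)"
    by (rule has_derivative_subset[OF u'(2)[OF x]]) (use assms(4) in auto)
  from diff_chain_within[OF p this]
  have d: "((\<lambda>y. u (y, t)) has_derivative (\<lambda>h. u' (y, t) (h, 0))) (at y)"
    using at_within_open[OF y assms(1)] by (simp add: o_def)
  have "(\<lambda>h. u' (y, t) (h, 0)) = (\<lambda>h. 0)"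
  proof (rule linear_eq_stdbasis)
    show "linear (\<lambda>h. u' (y, t) (h, 0))" using d has_derivative_linear by blast
    show "linear (\<lambda>h::real^'n. 0::real^'m)" by (rule linear_zero)
    fix b :: "real^'n" assume "b \<in> Basis"
    then show "u' (y, t) (b, 0) = 0"
      using z[OF y] u'(3)[OF x] by (simp add: lateral_density_eq_0_iff vec_eq_iff)
  qed
  with d show "((\<lambda>y. u (y, t)) has_derivative (\<lambda>h. 0)) (at y)" by simp
qed

text \<open>Every level set is \<open>D\<close> times a level set of a component of
  \<open>w\<close>. By injectivity the latter is empty or a single height, so an attained level of
  one component matches the value of the other at the same height.\<close>

lemma one_dimensional_common_level_sets:
  fixes D :: "(real^'n) set" and u :: "(real^'n) \<times> real \<Rightarrow> real^'m"
  assumes w: "\<And>y t. y \<in> D \<Longrightarrow> t \<in> {0..1} \<Longrightarrow> u (y, t) = w t"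
    and inj: "\<And>i. inj_on (\<lambda>t. w t $ i) {0..1}"
    and bdd: "\<And>i. bounded ((\<lambda>t. w t $ i) ` {0..1})"
  shows "common_level_sets D u"
  unfolding common_level_sets_def
proof (intro allI impI)
  fix i j :: 'm and l :: real
  have lev: "{x \<in> cyl D. u x $ k = m} = D \<times> {t \<in> {0..1}. w t $ k = m}" for k m
    using w by auto
  show "\<exists>l'. {x \<in> cyl D. u x $ i = l} = {x \<in> cyl D. u x $ j = l'}"
  proof (cases "l \<in> (\<lambda>t. w t $ i) ` {0..1}")
    case True
    then obtain t where t: "t \<in> {0..1}" "l = w t $ i" by blast
    then have "{s \<in> {0..1}. w s $ k = w t $ k} = {t}" for k
      using inj_onD[OF inj] by blast
    then have "{x \<in> cyl D. u x $ i = l} = {x \<in> cyl D. u x $ j = w t $ j}"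
      unfolding lev t(2) by simp
    then show ?thesis by blast
  next
    case False
    \<comment> \<open>An empty level set must be matched by an unattained level of the component
      \<open>j\<close>; with \<open>K\<close> bounding its absolute value, \<open>K + 1\<close> is
      one.\<close>
    obtain K where "\<forall>x\<in>(\<lambda>t. w t $ j) ` {0..1}. norm x \<le> K"
      using bdd[of j] unfolding bounded_iff by blast
    then have K: "\<bar>w t $ j\<bar> \<le> K" if "t \<in> {0..1}" for t
      using that by simp
    have "{t \<in> {0..1}. w t $ j = K + 1} = {}" using K by fastforce
    moreover have "{t \<in> {0..1}. w t $ i = l} = {}" using False by blast
    ultimately show ?thesis unfolding lev by (metis)
  qed
qed

theorem theorem4p1:
  fixes D :: "(real^'n) set"
    and H :: "real^'m \<Rightarrow> real"
    and a b :: "real^'m"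
    and u :: "(real^'n) \<times> real \<Rightarrow> real^'m"
  assumes "CARD('m) \<ge> 2"
    and "open D" and "connected D" and "D \<noteq> {}" and "bounded D"
    and "C2 H"
    and "orientable_on UNIV H"
    and "\<And>i j p. i \<noteq> j \<Longrightarrow> partial2 i j H p * (b $ i - a $ i) * (b $ j - a $ j) < 0"
    and "u \<in> admissible D H a b"
    and "\<And>v. v \<in> admissible D H a b \<Longrightarrow> energy D H u \<le> energy D H v"
  shows "(\<exists>w :: real \<Rightarrow> real^'m. \<forall>x'\<in>D. \<forall>t\<in>{0..1}. u (x', t) = w t) \<and>
         common_level_sets D u"
proof -
  obtain y0 where y0: "y0 \<in> D" using assms(4) by blast
  note C = admissibleD(1)[OF assms(9)] and nz = admissibleD(4)[OF assms(9)]
  \<comment> \<open>The slice over the arbitrary point \<open>y0\<close> serves as the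
    one-dimensional profile.\<close>
  have w: "u (y, t) = u (y0, t)" if "y \<in> D" "t \<in> {0..1}" for y t
    by (rule lateral_density_zero_imp_constant[OF assms(2,3) C that(2) _ that(1) y0])
      (rule minimizer_lateral_density_zero[OF assms(2,5,6,9,10) _ that(2)])
  have "continuous_on {0..1} (\<lambda>t. u (y0, t) $ i)" for i
    by (rule DERIV_continuous_on[OF dN_has_real_derivative[OF assms(2) C y0]])
  then have "bounded ((\<lambda>t. u (y0, t) $ i) ` {0..1})" for i
    by (intro compact_imp_bounded compact_continuous_image) auto
  then have "common_level_sets D u"
    using one_dimensional_common_level_sets[of D u "\<lambda>t. u (y0, t)"] w
      dN_nonzero_imp_inj_on[OF assms(2) C y0 nz] by blast
  moreover have "\<forall>x'\<in>D. \<forall>t\<in>{0..1}. u (x', t) = u (y0, t)"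
    by (intro ballI w)
  ultimately show ?thesis
    by (intro conjI exI[of _ "\<lambda>t. u (y0, t)"])
qed

end
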